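(* Let $A,B\in M_n(\mathbb{C})$ be positive definite. If $v,\tau$ are real numbers with $0<v\le\tau<1$, then $$\frac{v}{\tau}\left(A\nabla_\tau B-A!_\tau B\right)\le A\nabla_v B-A!_v B\le\frac{1-v}{1-\tau}\left(A\nabla_\tau B-A!_\tau B\right).$$
   Context: $M_n(\mathbb{C})$ is the space of $n\times n$ complex matrices. For positive definite $A,B\in M_n(\mathbb{C})$ and $0\le v\le 1$, the weighted arithmetic and harmonic means are $A\nabla_v B=vA+(1-v)B$ and $A!_v B=\left(vA^{-1}+(1-v)B^{-1}\right)^{-1}$. The inequality $\le$ between Hermitian matrices is the Löwner order: $S\le T$ means that $T-S$ is positive semidefinite. *)

theory Defs
  imports "HOL-Analysis.Analysis"
begin

definition conj_transpose :: "complex^'n^'m \<Rightarrow> complex^'m^'n" where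
  "conj_transpose A = transpose (map_matrix cnj A)"

definition hermitian :: "complex^'n^'n \<Rightarrow> bool" where
  "hermitian A \<longleftrightarrow> conj_transpose A = A"

text \<open>The scalar \<open>x\<^sup>* A x\<close>.\<close>
definition quad_form :: "complex^'n^'n \<Rightarrow> complex^'n \<Rightarrow> complex" where
  "quad_form A x = (\<Sum>i\<in>UNIV. cnj (x $ i) * (A *v x) $ i)"

text \<open>The inequalities below are in the order on \<^typ>\<open>complex\<close> from
  \<open>HOL-Library.Complex_Order\<close>, where \<open>0 \<le> z\<close> means that \<open>z\<close> is real and nonnegative.\<close>
definition pos_semidef :: "complex^'n^'n \<Rightarrow> bool" where
  "pos_semidef A \<longleftrightarrow> hermitian A \<and> (\<forall>x. 0 \<le> quad_form A x)"

definition pos_def :: "complex^'n^'n \<Rightarrow> bool" where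
  "pos_def A \<longleftrightarrow> hermitian A \<and> (\<forall>x. x \<noteq> 0 \<longrightarrow> 0 < quad_form A x)"

text \<open>The Loewner order gets its own symbol because \<open>\<le>\<close> on \<^typ>\<open>complex^'n^'n\<close> is
  already the entrywise order.\<close>
definition loewner_le :: "complex^'n^'n \<Rightarrow> complex^'n^'n \<Rightarrow> bool"
    (infix \<open>\<le>\<^sub>L\<close> 50) where
  "S \<le>\<^sub>L T \<longleftrightarrow> pos_semidef (T - S)"

text \<open>The weight \<open>v\<close> is attached to the first argument \<open>A\<close> in both means.\<close>
definition arith_mean :: "real \<Rightarrow> complex^'n^'n \<Rightarrow> complex^'n^'n \<Rightarrow> complex^'n^'n" where
  "arith_mean v A B = v *\<^sub>R A + (1 - v) *\<^sub>R B"

definition harm_mean :: "real \<Rightarrow> complex^'n^'n \<Rightarrow> complex^'n^'n \<Rightarrow> complex^'n^'n" where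
  "harm_mean v A B = matrix_inv (v *\<^sub>R matrix_inv A + (1 - v) *\<^sub>R matrix_inv B)"

end

theory Submission
  imports Defs
begin

text \<open>
  With \<open>M\<^sub>v = v B + (1 - v) A\<close> the harmonic mean is \<open>B M\<^sub>v\<^sup>-\<^sup>1 A = A M\<^sub>v\<^sup>-\<^sup>1 B\<close>, and the difference of the
  arithmetic and the harmonic mean equals \<open>v (1 - v) (A - B) M\<^sub>v\<^sup>-\<^sup>1 (A - B)\<close>. After cancelling the
  congruence by \<open>A - B\<close>, and since inversion reverses the Loewner order, the two inequalities reduce
  to \<open>(1 - \<tau>) M\<^sub>v \<le> (1 - v) M\<^sub>\<tau>\<close> and \<open>v M\<^sub>\<tau> \<le> \<tau> M\<^sub>v\<close>, where the differences are the nonnegative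
  multiples \<open>(\<tau> - v) B\<close> and \<open>(\<tau> - v) A\<close>.
\<close>

lemma matrix_add_rdistrib:
  fixes A :: "'a::semiring_1^'m^'n"
  shows "(A + B) ** C = A ** C + B ** C"
  by (vector matrix_matrix_mult_def distrib_right sum.distrib)

lemma matrix_diff_ldistrib:
  fixes A :: "'a::ring_1^'m^'n"
  shows "A ** (B - C) = A ** B - A ** C"
  by (vector matrix_matrix_mult_def right_diff_distrib sum_subtractf)

lemma matrix_diff_rdistrib:
  fixes A :: "'a::ring_1^'m^'n"
  shows "(A - B) ** C = A ** C - B ** C"
  by (vector matrix_matrix_mult_def left_diff_distrib sum_subtractf)

text \<open>As rewrite rules these expand products, nest them to the left and pull real scalars to
  the front.\<close>

lemmas matrix_ring_simps = matrix_add_ldistrib matrix_add_rdistrib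
  matrix_diff_ldistrib matrix_diff_rdistrib matrix_mul_assoc
  matrix_scalar_ac scalar_matrix_assoc[symmetric]

lemma matrix_inv_unique:
  fixes A B :: "'a::field^'n^'n"
  assumes "A ** B = mat 1"
  shows "matrix_inv A = B"
proof -
  have "invertible A"
    using assms invertible_right_inverse by blast
  then have "matrix_inv A ** A = mat 1"
    by (simp add: matrix_inv_def invertible_def) (metis (mono_tags, lifting) someI_ex)
  then have "matrix_inv A ** A ** B = B"
    by simp
  then show ?thesis
    using assms by (simp add: matrix_mul_assoc[symmetric])
qed

lemma matrix_inv_scaleR:
  fixes A :: "complex^'n^'n"
  assumes "A ** B = mat 1" "c \<noteq> 0"
  shows "matrix_inv (c *\<^sub>R A) = (1 / c) *\<^sub>R B"
  using assms by (intro matrix_inv_unique) (simp add: matrix_ring_simps)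

lemma conj_transpose_nth [simp]: "conj_transpose A $ i $ j = cnj (A $ j $ i)"
  by (simp add: conj_transpose_def transpose_def map_matrix_def)

lemma conj_transpose_conj_transpose [simp]: "conj_transpose (conj_transpose A) = A"
  by (simp add: vec_eq_iff)

lemma conj_transpose_mat_1 [simp]: "conj_transpose (mat 1) = mat 1"
  by (auto simp: vec_eq_iff mat_def)

lemma conj_transpose_add: "conj_transpose (A + B) = conj_transpose A + conj_transpose B"
  by (simp add: vec_eq_iff)

lemma conj_transpose_diff: "conj_transpose (A - B) = conj_transpose A - conj_transpose B"
  by (simp add: vec_eq_iff)

lemma conj_transpose_scaleR: "conj_transpose (c *\<^sub>R A) = c *\<^sub>R conj_transpose A"
  by (simp add: vec_eq_iff)

lemma conj_transpose_mult: "conj_transpose (A ** B) = conj_transpose B ** conj_transpose A"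
  by (simp add: vec_eq_iff matrix_matrix_mult_def mult.commute)

lemma quad_form_add: "quad_form (A + B) x = quad_form A x + quad_form B x"
  by (simp add: quad_form_def matrix_vector_mult_add_rdistrib distrib_left sum.distrib)

lemma quad_form_scaleR: "quad_form (c *\<^sub>R A) x = c *\<^sub>R quad_form A x"
  by (simp add: quad_form_def matrix_vector_mult_def scaleR_sum_right sum_distrib_left)

lemma quad_form_congruence:
  "quad_form (conj_transpose X ** S ** X) x = quad_form S (X *v x)"
proof -
  \<comment> \<open>The conjugate transpose is the adjoint for the standard inner product; both
    sides are the same double sum in different orders.\<close>
  have "(\<Sum>i\<in>UNIV. cnj (x $ i) * (conj_transpose X *v y) $ i)
      = (\<Sum>i\<in>UNIV. cnj ((X *v x) $ i) * y $ i)" for y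
    unfolding matrix_vector_mult_def
    by (simp add: sum_distrib_left sum_distrib_right mult_ac) (subst sum.swap, simp)
  then show ?thesis
    by (simp add: quad_form_def matrix_vector_mul_assoc[symmetric])
qed

lemma pos_semidef_add: "pos_semidef A \<Longrightarrow> pos_semidef B \<Longrightarrow> pos_semidef (A + B)"
  by (simp add: pos_semidef_def hermitian_def conj_transpose_add quad_form_add)

lemma pos_semidef_scaleR: "pos_semidef A \<Longrightarrow> 0 \<le> c \<Longrightarrow> pos_semidef (c *\<^sub>R A)"
  by (simp add: pos_semidef_def hermitian_def conj_transpose_scaleR quad_form_scaleR
      scaleR_nonneg_nonneg)

lemma pos_semidef_congruence:
  "pos_semidef S \<Longrightarrow> pos_semidef (conj_transpose X ** S ** X)"
  by (simp add: pos_semidef_def hermitian_def conj_transpose_mult quad_form_congruence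
      matrix_mul_assoc)

lemma pos_def_add: "pos_def A \<Longrightarrow> pos_def B \<Longrightarrow> pos_def (A + B)"
  by (simp add: pos_def_def hermitian_def conj_transpose_add quad_form_add add_pos_pos)

lemma pos_def_scaleR: "pos_def A \<Longrightarrow> 0 < c \<Longrightarrow> pos_def (c *\<^sub>R A)"
  by (simp add: pos_def_def hermitian_def conj_transpose_scaleR quad_form_scaleR
      less_complex_def)

lemma pos_def_imp_pos_semidef: "pos_def A \<Longrightarrow> pos_semidef A"
  unfolding pos_def_def pos_semidef_def
  by (metis (no_types, lifting) less_imp_le mult_zero_left complex_cnj_zero order_refl
      quad_form_def sum.neutral zero_index)

lemma pos_def_inverseE:
  assumes "pos_def A"
  obtains N where "A ** N = mat 1" "N ** A = mat 1" "matrix_inv A = N" "hermitian N"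
proof -
  \<comment> \<open>A kernel vector has quadratic form 0, so positivity forces a trivial kernel and
    hence a left inverse.\<close>
  have "x = 0" if "A *v x = 0" for x
    using assms that by (force simp: pos_def_def quad_form_def)
  then obtain N where N: "N ** A = mat 1"
    using matrix_left_invertible_ker by blast
  then have N': "A ** N = mat 1"
    using matrix_left_right_inverse by blast
  \<comment> \<open>Since \<open>A\<close> is Hermitian, the conjugate transpose of \<open>N\<close>
    is again a right inverse; uniqueness makes \<open>N\<close> Hermitian.\<close>
  have "A ** conj_transpose N = conj_transpose (N ** A)"
    using assms by (simp add: conj_transpose_mult pos_def_def hermitian_def)
  then have "matrix_inv A = conj_transpose N"
    using N by (intro matrix_inv_unique) simp
  with matrix_inv_unique[OF N'] have "hermitian N"
    by (simp add: hermitian_def)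
  with N N' matrix_inv_unique[OF N'] that show thesis by blast
qed

text \<open>The identity \<open>P\<^sup>-\<^sup>1 - Q\<^sup>-\<^sup>1 = (P\<^sup>-\<^sup>1 - Q\<^sup>-\<^sup>1) P (P\<^sup>-\<^sup>1 - Q\<^sup>-\<^sup>1) + Q\<^sup>-\<^sup>1 (Q - P) Q\<^sup>-\<^sup>1\<close>
  exhibits the difference as a sum of two congruences and avoids square roots.\<close>
lemma matrix_inv_antimono:
  assumes "pos_def P" "pos_def Q" "P \<le>\<^sub>L Q"
  shows "matrix_inv Q \<le>\<^sub>L matrix_inv P"
proof -
  obtain N where N: "P ** N = mat 1" "N ** P = mat 1" "matrix_inv P = N" "hermitian N"
    using assms(1) by (rule pos_def_inverseE)
  obtain K where K: "Q ** K = mat 1" "K ** Q = mat 1" "matrix_inv Q = K" "hermitian K"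
    using assms(2) by (rule pos_def_inverseE)
  have herm: "conj_transpose (N - K) = N - K" "conj_transpose K = K"
    using N(4) K(4) by (simp_all add: hermitian_def conj_transpose_diff)
  \<comment> \<open>The one mixed term of the expansion in which left nesting hides the cancelling
    factor \<open>P ** N\<close>.\<close>
  have "K ** P ** N = K"
    using N(1) by (simp add: matrix_mul_assoc[symmetric])
  then have "N - K = (N - K) ** P ** (N - K) + K ** (Q - P) ** K"
    by (simp add: matrix_ring_simps N K)
  also have "pos_semidef \<dots>"
    using pos_semidef_congruence[of P "N - K"] pos_semidef_congruence[of "Q - P" K] assms
    by (auto simp: herm loewner_le_def intro: pos_semidef_add pos_def_imp_pos_semidef)
  finally show ?thesis
    by (simp add: loewner_le_def N K)
qed

lemma scaled_matrix_inv_antimono: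
  assumes "pos_def P" "pos_def Q" "0 < a" "0 < b" "a *\<^sub>R P \<le>\<^sub>L b *\<^sub>R Q"
  shows "a *\<^sub>R matrix_inv Q \<le>\<^sub>L b *\<^sub>R matrix_inv P"
proof -
  obtain N where N: "P ** N = mat 1" "matrix_inv P = N"
    using assms(1) by (rule pos_def_inverseE)
  obtain K where K: "Q ** K = mat 1" "matrix_inv Q = K"
    using assms(2) by (rule pos_def_inverseE)
  have "matrix_inv (b *\<^sub>R Q) \<le>\<^sub>L matrix_inv (a *\<^sub>R P)"
    using assms by (intro matrix_inv_antimono pos_def_scaleR)
  then have "pos_semidef ((1 / a) *\<^sub>R N - (1 / b) *\<^sub>R K)"
    using assms N K by (simp add: loewner_le_def matrix_inv_scaleR)
  \<comment> \<open>Multiplying by \<open>a * b\<close> clears the denominators and swaps the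
    scalars: \<open>b\<close> lands on \<open>N\<close>, \<open>a\<close> on
    \<open>K\<close>.\<close>
  then have "pos_semidef ((a * b) *\<^sub>R ((1 / a) *\<^sub>R N - (1 / b) *\<^sub>R K))"
    using assms by (intro pos_semidef_scaleR) auto
  then show ?thesis
    using assms by (simp add: loewner_le_def N K scaleR_right_diff_distrib)
qed

lemma arith_minus_harm:
  fixes A B :: "complex^'n^'n"
  assumes "pos_def A" "pos_def B" "0 < v" "v < 1"
  shows "arith_mean v A B - harm_mean v A B
    = (v * (1 - v)) *\<^sub>R ((A - B) ** matrix_inv (v *\<^sub>R B + (1 - v) *\<^sub>R A) ** (A - B))"
proof -
  define w where "w = 1 - v"
  \<comment> \<open>Writing 1 as a square lets the final computation be homogeneous of degree two in
    \<open>v\<close> and \<open>w\<close>.\<close>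
  have w: "0 < w" "1 = (v + w)\<^sup>2"
    using assms by (simp_all add: w_def)
  define M where "M = v *\<^sub>R B + w *\<^sub>R A"
  have "pos_def M"
    using assms w by (simp add: M_def pos_def_add pos_def_scaleR)
  then obtain N where N: "M ** N = mat 1" "N ** M = mat 1" "matrix_inv M = N"
    by (rule pos_def_inverseE)
  obtain A' where A': "A ** A' = mat 1" "A' ** A = mat 1" "matrix_inv A = A'"
    using assms(1) by (rule pos_def_inverseE)
  obtain B' where B': "B ** B' = mat 1" "B' ** B = mat 1" "matrix_inv B = B'"
    using assms(2) by (rule pos_def_inverseE)
  \<comment> \<open>The weights in \<open>M\<close> are crossed because \<open>A'\<close> cancels
    \<open>A\<close> and leaves \<open>B'\<close>, while \<open>B'\<close> cancels \<open>B\<close>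
    and leaves \<open>A'\<close>.\<close>
  have "A' ** M ** B' = v *\<^sub>R A' + w *\<^sub>R B'"
    by (simp add: M_def matrix_ring_simps A')
       (simp add: matrix_mul_assoc[symmetric] B')
  moreover have "(A' ** M ** B') ** (B ** N ** A) = A' ** M ** (B' ** B) ** N ** A"
    by (simp add: matrix_mul_assoc)
  moreover have "\<dots> = A' ** (M ** N) ** A"
    by (simp add: B' matrix_mul_assoc)
  ultimately have "(v *\<^sub>R A' + w *\<^sub>R B') ** (B ** N ** A) = mat 1"
    by (simp add: N A')
  then have harm: "harm_mean v A B = B ** N ** A"
    unfolding harm_mean_def A'(3) B'(3) w_def by (rule matrix_inv_unique)
  \<comment> \<open>Expanding \<open>M\<close> in \<open>M ** N ** A\<close>,
    \<open>A ** N ** M\<close> and \<open>B ** N ** M\<close> expresses \<open>A\<close> and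
    \<open>B\<close> through products with \<open>N\<close> in the middle. The two expansions of
    \<open>A\<close> then yield \<open>comm\<close>.\<close>
  have eA: "A = v *\<^sub>R (B ** N ** A) + w *\<^sub>R (A ** N ** A)"
    using arg_cong[OF N(1), of "\<lambda>X. X ** A"] by (simp add: M_def matrix_ring_simps)
  have eA': "A = v *\<^sub>R (A ** N ** B) + w *\<^sub>R (A ** N ** A)"
    using arg_cong[OF N(2), of "\<lambda>X. A ** X"] by (simp add: M_def matrix_ring_simps)
  have eB: "B = v *\<^sub>R (B ** N ** B) + w *\<^sub>R (B ** N ** A)"
    using arg_cong[OF N(2), of "\<lambda>X. B ** X"] by (simp add: M_def matrix_ring_simps)
  have "v *\<^sub>R (A ** N ** B) = v *\<^sub>R (B ** N ** A)"
    using eA eA' by (metis add_right_cancel)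
  then have comm: "A ** N ** B = B ** N ** A"
    using assms by simp
  \<comment> \<open>The \<open>v\<^sup>2\<close> and \<open>w\<^sup>2\<close> terms cancel; by
    \<open>comm\<close>, the remaining -2 \<open>v * w\<close> multiple of
    \<open>B ** N ** A\<close> supplies both cross terms of the congruence.\<close>
  have "v *\<^sub>R A + w *\<^sub>R B - B ** N ** A
      = v *\<^sub>R (v *\<^sub>R (B ** N ** A) + w *\<^sub>R (A ** N ** A))
        + w *\<^sub>R (v *\<^sub>R (B ** N ** B) + w *\<^sub>R (B ** N ** A)) - (v + w)\<^sup>2 *\<^sub>R (B ** N ** A)"
    using eA eB w by simp
  also have "\<dots> = (v * w) *\<^sub>R ((A - B) ** N ** (A - B))"
    by (simp add: matrix_ring_simps comm power2_eq_square algebra_simps)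
       (simp add: vec_eq_iff scaleR_conv_of_real)
  finally show ?thesis
    by (simp add: arith_mean_def harm w_def[symmetric] M_def[symmetric] N)
qed

lemma loewner_le_congruence_scaleR:
  assumes "S \<le>\<^sub>L T" "hermitian D" "0 \<le> c"
  shows "c *\<^sub>R (D ** S ** D) \<le>\<^sub>L c *\<^sub>R (D ** T ** D)"
proof -
  have "pos_semidef (c *\<^sub>R (D ** (T - S) ** D))"
    using assms pos_semidef_congruence[of "T - S" D]
    by (simp add: loewner_le_def hermitian_def pos_semidef_scaleR)
  then show ?thesis
    by (simp add: loewner_le_def matrix_ring_simps scaleR_right_diff_distrib)
qed

theorem theorem3p2:
  fixes A B :: "complex^'n^'n" and v \<tau> :: real
  assumes "pos_def A" and "pos_def B"
    and "0 < v" and "v \<le> \<tau>" and "\<tau> < 1"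
  shows "(v / \<tau>) *\<^sub>R (arith_mean \<tau> A B - harm_mean \<tau> A B)
           \<le>\<^sub>L arith_mean v A B - harm_mean v A B
       \<and> arith_mean v A B - harm_mean v A B
           \<le>\<^sub>L ((1 - v) / (1 - \<tau>)) *\<^sub>R (arith_mean \<tau> A B - harm_mean \<tau> A B)"
proof -
  define M where "M = (\<lambda>t. t *\<^sub>R B + (1 - t) *\<^sub>R A)"
  define D where "D = A - B"
  have D: "hermitian D"
    using assms by (simp add: D_def pos_def_def hermitian_def conj_transpose_diff)
  have M: "pos_def (M v)" "pos_def (M \<tau>)"
    using assms by (simp_all add: M_def pos_def_add pos_def_scaleR)
  have gap: "arith_mean t A B - harm_mean t A B
      = (t * (1 - t)) *\<^sub>R (D ** matrix_inv (M t) ** D)" if "0 < t" "t < 1" for t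
    using arith_minus_harm[OF assms(1,2) that] by (simp add: M_def D_def)
  have "(1 - v) *\<^sub>R M \<tau> - (1 - \<tau>) *\<^sub>R M v = (\<tau> - v) *\<^sub>R B"
    by (simp add: M_def algebra_simps)
  then have "(1 - \<tau>) *\<^sub>R M v \<le>\<^sub>L (1 - v) *\<^sub>R M \<tau>"
    using assms by (simp add: loewner_le_def pos_semidef_scaleR pos_def_imp_pos_semidef)
  then have "(1 - \<tau>) *\<^sub>R matrix_inv (M \<tau>) \<le>\<^sub>L (1 - v) *\<^sub>R matrix_inv (M v)"
    using assms M by (intro scaled_matrix_inv_antimono) auto
  \<comment> \<open>The factor \<open>v\<close> turns the right side into the gap at
    \<open>v\<close>; on the left, v (1 - \<tau>) is v / \<tau> times the coefficient \<tau> (1 -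
    \<tau>) of the gap at \<tau>.\<close>
  then have lower: "v *\<^sub>R (D ** ((1 - \<tau>) *\<^sub>R matrix_inv (M \<tau>)) ** D)
      \<le>\<^sub>L v *\<^sub>R (D ** ((1 - v) *\<^sub>R matrix_inv (M v)) ** D)"
    using assms D by (intro loewner_le_congruence_scaleR) auto
  have "\<tau> *\<^sub>R M v - v *\<^sub>R M \<tau> = (\<tau> - v) *\<^sub>R A"
    by (simp add: M_def algebra_simps)
  then have "v *\<^sub>R M \<tau> \<le>\<^sub>L \<tau> *\<^sub>R M v"
    using assms by (simp add: loewner_le_def pos_semidef_scaleR pos_def_imp_pos_semidef)
  then have "v *\<^sub>R matrix_inv (M v) \<le>\<^sub>L \<tau> *\<^sub>R matrix_inv (M \<tau>)"
    using assms M by (intro scaled_matrix_inv_antimono) auto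
  \<comment> \<open>Here the factor is \<open>1 - v\<close>, and (1 - v) \<tau> is (1 - v) / (1 -
    \<tau>) times \<tau> (1 - \<tau>).\<close>
  then have upper: "(1 - v) *\<^sub>R (D ** (v *\<^sub>R matrix_inv (M v)) ** D)
      \<le>\<^sub>L (1 - v) *\<^sub>R (D ** (\<tau> *\<^sub>R matrix_inv (M \<tau>)) ** D)"
    using assms D by (intro loewner_le_congruence_scaleR) auto
  show ?thesis
    using lower upper assms by (simp add: gap matrix_ring_simps mult.commute)
qed

end
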